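(* Let $A,B$ be symmetric operators in a real or complex Hilbert space $H$ with common dense domain $\mathscr{D}=\operatorname{dom}A=\operatorname{dom}B$. Assume that $A$ is selfadjoint and that $(Ax\,|\,By)=(Bx\,|\,Ay)$ for all $x,y\in\mathscr{D}$. Then $B$ and $A+B$ are both essentially selfadjoint on $\mathscr{D}$.
   Context: Operators are (possibly unbounded) linear maps defined on a linear subspace of $H$. An operator $A$ is symmetric if $(Ax\,|\,y)=(x\,|\,Ay)$ for all $x,y\in\operatorname{dom}A$. An operator is essentially selfadjoint on a subspace $\mathscr{D}$ of its domain if its restriction to $\mathscr{D}$ is closable and the closure of that restriction is selfadjoint. *)

theory Defs
  imports "HOL-Analysis.Analysis"
begin

section \<open>Real or complex scalars\<close>

text \<open>
  A common interface to the scalar fields \<open>real\<close> and \<open>complex\<close>. Up to isomorphism there are no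
  other instances, see \<open>real_or_complex_cases\<close> below.
\<close>

class real_or_complex = real_normed_field +
  fixes conjugate :: "'a \<Rightarrow> 'a"
  assumes conjugate_add: "conjugate (x + y) = conjugate x + conjugate y"
    and conjugate_mult: "conjugate (x * y) = conjugate x * conjugate y"
    and conjugate_conjugate: "conjugate (conjugate x) = x"
    and mult_conjugate_scaleR: "x * conjugate x = (norm x)\<^sup>2 *\<^sub>R 1"

lemma mult_conjugate: "x * conjugate x = of_real ((norm x)\<^sup>2)"
  for x :: "'k::real_or_complex"
  by (simp add: mult_conjugate_scaleR of_real_def)

instantiation real :: real_or_complex
begin

definition conjugate_real :: "real \<Rightarrow> real" where "conjugate_real x = x"

instance
  by standard (auto simp: conjugate_real_def power2_eq_square)

end

instantiation complex :: real_or_complex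
begin

definition conjugate_complex :: "complex \<Rightarrow> complex" where "conjugate_complex = cnj"

instance
  by standard (simp_all add: conjugate_complex_def scaleR_conv_of_real flip: complex_norm_square)

end

lemma add_conjugate_Reals:
  fixes x :: "'k::real_or_complex"
  shows "x + conjugate x \<in> \<real>"
proof -
  have c1: "conjugate (1 :: 'k) = 1"
    using mult_conjugate[of "1 :: 'k"] by simp
  have "(x + 1) * conjugate (x + 1) = x * conjugate x + (x + conjugate x) + 1"
    by (simp add: conjugate_add c1 algebra_simps)
  then have "x + conjugate x = of_real ((norm (x + 1))\<^sup>2 - (norm x)\<^sup>2 - 1)"
    by (simp add: mult_conjugate algebra_simps)
  then show ?thesis
    by (metis Reals_of_real)
qed

lemma real_or_complex_decomp:
  fixes x :: "'k::real_or_complex"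
  obtains a b and i :: 'k where "x = of_real a + of_real b * i" "x \<in> \<real> \<or> i * i = -1"
proof -
  obtain t where t: "x + conjugate x = of_real (2 * t)"
  proof -
    obtain r where "x + conjugate x = of_real r"
      using add_conjugate_Reals[of x] by (auto elim: Reals_cases)
    then show ?thesis using that[of "r / 2"] by simp
  qed
  define s where "s = (norm x)\<^sup>2 - t\<^sup>2"
  have conjugate_x: "conjugate x = of_real (2 * t) - x"
    using t by (simp add: algebra_simps)
  have "x * (of_real (2 * t) - x) = of_real ((norm x)\<^sup>2)"
    using mult_conjugate[of x] by (simp add: conjugate_x)
  then have sq: "(x - of_real t) * (x - of_real t) = - of_real s"
    by (simp add: s_def algebra_simps power2_eq_square)
  show ?thesis
  proof (cases "s > 0")
    case True
    then have ss: "of_real (sqrt s) * of_real (sqrt s) = (of_real s :: 'k)"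
      by (simp flip: of_real_mult)
    have nz: "of_real (sqrt s) \<noteq> (0 :: 'k)" "of_real s \<noteq> (0 :: 'k)" using True by auto
    define i where "i = (x - of_real t) / of_real (sqrt s)"
    have "i * i = ((x - of_real t) * (x - of_real t)) / of_real s"
      by (simp only: i_def times_divide_times_eq ss)
    then have "i * i = -1" using sq nz by simp
    moreover have "x = of_real t + of_real (sqrt s) * i"
      using nz by (simp add: i_def)
    ultimately show ?thesis using that by blast
  next
    case False
    then have "of_real (sqrt (- s)) * of_real (sqrt (- s)) = - (of_real s :: 'k)"
      by (simp flip: of_real_mult of_real_minus)
    then have "(x - of_real t) * (x - of_real t) = of_real (sqrt (- s)) * of_real (sqrt (- s))"
      using sq by simp
    then have "x - of_real t = of_real (sqrt (- s)) \<or> x - of_real t = - of_real (sqrt (- s))"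
      by (simp only: square_eq_iff)
    then have "x = of_real (t + sqrt (- s)) \<or> x = of_real (t - sqrt (- s))"
      by (auto simp: algebra_simps)
    then show ?thesis
    proof
      assume "x = of_real (t + sqrt (- s))"
      then show ?thesis using that[of "t + sqrt (- s)" 0 0] by simp
    next
      assume "x = of_real (t - sqrt (- s))"
      then show ?thesis using that[of "t - sqrt (- s)" 0 0] by simp
    qed
  qed
qed

lemma real_or_complex_cases:
  "(UNIV :: 'k::real_or_complex set) = \<real> \<or>
   (\<exists>i::'k. i * i = -1 \<and> (\<forall>x. \<exists>a b. x = of_real a + of_real b * i))"
proof (cases "(UNIV :: 'k set) = \<real>")
  case False
  then obtain z :: 'k where z: "z \<notin> \<real>" by auto
  obtain a b and i :: 'k where i: "i * i = -1"
    using real_or_complex_decomp[of z] z by metis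
  have "\<exists>a b. x = of_real a + of_real b * i" for x
  proof (cases "x \<in> \<real>")
    case True
    then obtain r where "x = of_real r" by (auto elim: Reals_cases)
    then have "x = of_real r + of_real 0 * i" by simp
    then show ?thesis by blast
  next
    case False
    then obtain a b and j :: 'k where x: "x = of_real a + of_real b * j" and j: "j * j = -1"
      using real_or_complex_decomp[of x] by metis
    have "j * j = i * i" using i j by simp
    then have "j = i \<or> j = - i" by (simp only: square_eq_iff)
    then have "x = of_real a + of_real b * i \<or> x = of_real a + of_real (- b) * i"
      using x by auto
    then show ?thesis by blast
  qed
  then show ?thesis using i by blast
qed auto

section \<open>Hilbert spaces\<close>

text \<open>
  The space is the type \<open>'a\<close>, whose norm is required to come from the inner product \<open>ip\<close>;
  completeness is part of the sort \<open>banach\<close>. The inner product is linear in its first argument.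
\<close>

locale hilbert_space = vector_space smul
  for smul :: "'k::real_or_complex \<Rightarrow> 'a::banach \<Rightarrow> 'a" +
  fixes ip :: "'a \<Rightarrow> 'a \<Rightarrow> 'k"
  assumes smul_of_real: "smul (of_real r) x = r *\<^sub>R x"
    and ip_add_left: "ip (x + y) z = ip x z + ip y z"
    and ip_smul_left: "ip (smul c x) y = c * ip x y"
    and ip_commute: "ip y x = conjugate (ip x y)"
    and ip_self: "ip x x = of_real ((norm x)\<^sup>2)"

lemma hilbert_space_real:
  "hilbert_space (*\<^sub>R) (inner :: 'a::{real_inner, banach} \<Rightarrow> 'a \<Rightarrow> real)"
  by unfold_locales
    (auto simp: conjugate_real_def inner_commute inner_left_distrib power2_norm_eq_inner algebra_simps)

lemma hilbert_space_complex: "hilbert_space (*) (\<lambda>x y :: complex. x * cnj y)"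
  by unfold_locales
    (simp_all add: conjugate_complex_def scaleR_conv_of_real algebra_simps flip: complex_norm_square)

section \<open>Unbounded operators\<close>

text \<open>
  An operator is a partial function whose domain \<open>dom A\<close> is a subspace and which is linear there.
\<close>

definition linear_operator :: "('k::field \<Rightarrow> 'a::ab_group_add \<Rightarrow> 'a) \<Rightarrow> ('a \<rightharpoonup> 'a) \<Rightarrow> bool" where
  "linear_operator smul A \<longleftrightarrow>
     module.subspace smul (dom A) \<and>
     (\<forall>x\<in>dom A. \<forall>y\<in>dom A. the (A (x + y)) = the (A x) + the (A y)) \<and>
     (\<forall>c. \<forall>x\<in>dom A. the (A (smul c x)) = smul c (the (A x)))"

definition add_operator :: "('a::ab_group_add \<rightharpoonup> 'a) \<Rightarrow> ('a \<rightharpoonup> 'a) \<Rightarrow> ('a \<rightharpoonup> 'a)" where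
  "add_operator A B =
     (\<lambda>x. if x \<in> dom A \<inter> dom B then Some (the (A x) + the (B x)) else None)"

definition symmetric_operator :: "('a \<Rightarrow> 'a \<Rightarrow> 'k) \<Rightarrow> ('a \<rightharpoonup> 'a) \<Rightarrow> bool" where
  "symmetric_operator ip A \<longleftrightarrow>
     (\<forall>x\<in>dom A. \<forall>y\<in>dom A. ip (the (A x)) y = ip x (the (A y)))"

text \<open>
  The vector \<open>z\<close> below is unique if \<open>dom A\<close> is dense; the adjoint is meaningful only in that case.
\<close>

definition adjoint_operator :: "('a \<Rightarrow> 'a \<Rightarrow> 'k) \<Rightarrow> ('a \<rightharpoonup> 'a) \<Rightarrow> ('a \<rightharpoonup> 'a)" where
  "adjoint_operator ip A =
     (\<lambda>y. if \<exists>z. \<forall>x\<in>dom A. ip (the (A x)) y = ip x z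
          then Some (THE z. \<forall>x\<in>dom A. ip (the (A x)) y = ip x z) else None)"

definition selfadjoint_operator ::
  "('a::topological_space \<Rightarrow> 'a \<Rightarrow> 'k) \<Rightarrow> ('a \<rightharpoonup> 'a) \<Rightarrow> bool" where
  "selfadjoint_operator ip A \<longleftrightarrow> closure (dom A) = UNIV \<and> adjoint_operator ip A = A"

definition closable_operator :: "('a::topological_space \<rightharpoonup> 'a) \<Rightarrow> bool" where
  "closable_operator A \<longleftrightarrow> single_valued (closure (Map.graph A))"

text \<open>For closable \<open>A\<close>, the operator whose graph is the closure of the graph of \<open>A\<close>.\<close>

definition closure_operator :: "('a::topological_space \<rightharpoonup> 'a) \<Rightarrow> ('a \<rightharpoonup> 'a)" where
  "closure_operator A =
     (\<lambda>x. if \<exists>y. (x, y) \<in> closure (Map.graph A)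
          then Some (THE y. (x, y) \<in> closure (Map.graph A)) else None)"

lemma graph_closure_operator:
  assumes "closable_operator A"
  shows "Map.graph (closure_operator A) = closure (Map.graph A)"
proof -
  have "(THE y. (x, y) \<in> closure (Map.graph A)) = y" if "(x, y) \<in> closure (Map.graph A)" for x y
    using assms that unfolding closable_operator_def single_valued_def by blast
  then have "(x, y) \<in> Map.graph (closure_operator A) \<longleftrightarrow> (x, y) \<in> closure (Map.graph A)" for x y
    unfolding Map.graph_def[of "closure_operator A"] by (auto simp: closure_operator_def split: if_splits)
  then show ?thesis
    by auto
qed

definition essentially_selfadjoint_on ::
  "('k::field \<Rightarrow> 'a::{ab_group_add, topological_space} \<Rightarrow> 'a) \<Rightarrow> ('a \<Rightarrow> 'a \<Rightarrow> 'k) \<Rightarrow>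
   ('a \<rightharpoonup> 'a) \<Rightarrow> 'a set \<Rightarrow> bool" where
  "essentially_selfadjoint_on smul ip A D \<longleftrightarrow>
     module.subspace smul D \<and> D \<subseteq> dom A \<and>
     closable_operator (A |` D) \<and> selfadjoint_operator ip (closure_operator (A |` D))"

end

theory Submission
  imports Defs
begin

text \<open>
  For \<open>s > 0\<close>, minimising \<open>\<parallel>y - x\<parallel>\<^sup>2 + s \<parallel>A x\<parallel>\<^sup>2\<close> over \<open>x \<in> dom A\<close> yields \<open>R\<^sub>s y = (1 + s A\<^sup>2)\<inverse> y\<close>, and
  minimality together with the density of \<open>dom A\<close> gives \<open>R\<^sub>s y \<rightarrow> y\<close> as \<open>s \<rightarrow> 0\<close>; this works over both
  scalar fields. The commutation hypothesis implies \<open>B R\<^sub>s y = R\<^sub>s B\<^sup>* y\<close> for \<open>y \<in> dom B\<^sup>*\<close>, so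
  \<open>(R\<^sub>s y, B R\<^sub>s y)\<close> converges to \<open>(y, B\<^sup>* y)\<close> and \<open>B\<^sup>*\<close> is the closure of \<open>B\<close>. The operator \<open>A + B\<close>
  satisfies the same hypotheses as \<open>B\<close>.
\<close>

section \<open>Conjugation and sequences in closures\<close>

lemma conjugate_zero [simp]: "conjugate (0 :: 'k::real_or_complex) = 0"
  using conjugate_add[of "0 :: 'k" 0] by simp

text \<open>The identity \<open>x * conjugate x = (norm x)^2\<close> at \<open>x = of_real r\<close>
  reduces to this after cancelling \<open>of_real r\<close>.\<close>

lemma conjugate_of_real [simp]: "conjugate (of_real r :: 'k::real_or_complex) = of_real r"
proof (cases "r = 0")
  case False
  have "of_real r * conjugate (of_real r :: 'k) = of_real r * of_real r"
    by (simp add: mult_conjugate power2_eq_square)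
  then show ?thesis using False by simp
qed simp

lemma conjugate_minus: "conjugate (- x) = - conjugate x" for x :: "'k::real_or_complex"
  using conjugate_add[of x "- x"] by (simp add: eq_neg_iff_add_eq_0 add.commute)

lemma conjugate_diff: "conjugate (x - y) = conjugate x - conjugate y" for x :: "'k::real_or_complex"
  using conjugate_add[of x "- y"] by (simp add: conjugate_minus)

lemma mem_closure_seqE:
  fixes x :: "'a::metric_space"
  assumes "x \<in> closure S"
  obtains f where "\<And>n. f n \<in> S" "f \<longlonglongrightarrow> x"
  using assms closure_sequential by blast

lemma mem_closure_graphE:
  fixes B :: "'a::metric_space \<rightharpoonup> 'b::metric_space"
  assumes "(x, y) \<in> closure (Map.graph B)"
  obtains f where "\<And>n. f n \<in> dom B" "f \<longlonglongrightarrow> x" "(\<lambda>n. the (B (f n))) \<longlonglongrightarrow> y"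
proof -
  obtain p where p: "\<And>n. p n \<in> Map.graph B" "p \<longlonglongrightarrow> (x, y)"
    using assms by (rule mem_closure_seqE) blast
  have B: "B (fst (p n)) = Some (snd (p n))" for n
    using p(1)[of n] by (auto simp: Map.graph_def)
  show ?thesis
  proof
    show "fst (p n) \<in> dom B" for n using B by blast
    show "(\<lambda>n. fst (p n)) \<longlonglongrightarrow> x" using tendsto_fst[OF p(2)] by simp
    show "(\<lambda>n. the (B (fst (p n)))) \<longlonglongrightarrow> y" using tendsto_snd[OF p(2)] by (simp add: B)
  qed
qed

section \<open>Inner product calculus over either scalar field\<close>

context hilbert_space
begin

lemma ip_add_right: "ip x (y + z) = ip x y + ip x z"
  by (metis ip_add_left ip_commute conjugate_add)

lemma ip_smul_right: "ip x (smul c y) = conjugate c * ip x y"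
  by (metis ip_smul_left ip_commute conjugate_mult)

lemma ip_scaleR_left: "ip (r *\<^sub>R x) y = of_real r * ip x y"
  by (metis smul_of_real ip_smul_left)

lemma ip_scaleR_right: "ip x (r *\<^sub>R y) = of_real r * ip x y"
  by (metis smul_of_real ip_smul_right conjugate_of_real)

lemma ip_minus_left: "ip (- x) y = - ip x y"
  using ip_scaleR_left[of "-1"] by simp

lemma ip_minus_right: "ip x (- y) = - ip x y"
  using ip_scaleR_right[of x "-1"] by simp

lemma ip_diff_left: "ip (x - y) z = ip x z - ip y z"
  using ip_add_left[of x "- y"] by (simp add: ip_minus_left)

lemma ip_diff_right: "ip x (y - z) = ip x y - ip x z"
  using ip_add_right[of x y "- z"] by (simp add: ip_minus_right)

lemma parallelogram:
  fixes x y :: 'a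
  shows "(norm (x + y))\<^sup>2 + (norm (x - y))\<^sup>2 = 2 * (norm x)\<^sup>2 + 2 * (norm y)\<^sup>2"
proof -
  have "of_real ((norm (x + y))\<^sup>2) + of_real ((norm (x - y))\<^sup>2) =
      2 * of_real ((norm x)\<^sup>2) + (2 * of_real ((norm y)\<^sup>2) :: 'k)"
    unfolding ip_self[symmetric]
    by (simp add: ip_add_left ip_add_right ip_diff_left ip_diff_right)
  then have "of_real ((norm (x + y))\<^sup>2 + (norm (x - y))\<^sup>2) =
      (of_real (2 * (norm x)\<^sup>2 + 2 * (norm y)\<^sup>2) :: 'k)"
    by simp
  then show ?thesis by (simp only: of_real_eq_iff)
qed

text \<open>The cross term stays a sum of two conjugate scalars because the scalar class offers no
  real part. It serves both the Cauchy-Schwarz inequality and the first variation of the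
  minimisation problem.\<close>

lemma norm_diff_smul_sq:
  "of_real ((norm (x - smul c y))\<^sup>2) = of_real ((norm x)\<^sup>2) + of_real ((norm c)\<^sup>2 * (norm y)\<^sup>2)
     - (conjugate c * ip x y + c * conjugate (ip x y))"
proof -
  have "ip (x - smul c y) (x - smul c y) =
      ip x x + (c * conjugate c) * ip y y - (conjugate c * ip x y + c * ip y x)"
    by (simp add: ip_diff_left ip_diff_right ip_smul_left ip_smul_right algebra_simps)
  then show ?thesis
    by (simp add: ip_self mult_conjugate flip: ip_commute)
qed

text \<open>Cauchy-Schwarz: \<open>c\<close> is the coefficient of the orthogonal projection of
  \<open>x\<close> onto \<open>y\<close>, and the squared norm of the remainder
  \<open>x - smul c y\<close> is nonnegative.\<close>

lemma norm_ip_le: "norm (ip x y) \<le> norm x * norm y"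
proof (cases "y = 0")
  case True
  then show ?thesis using ip_scaleR_right[of x 0 y] by simp
next
  case False
  define t where "t = inverse ((norm y)\<^sup>2)"
  define c where "c = of_real t * ip x y"
  have t: "t * (norm y)\<^sup>2 = 1" using False by (simp add: t_def)
  have c: "conjugate c * ip x y + c * conjugate (ip x y) = of_real (2 * t * (norm (ip x y))\<^sup>2)"
    using mult_conjugate[of "ip x y"] by (simp add: c_def conjugate_mult mult_ac)
  have "(norm c)\<^sup>2 * (norm y)\<^sup>2 = t * (norm (ip x y))\<^sup>2 * (t * (norm y)\<^sup>2)"
    by (simp add: c_def norm_mult power_mult_distrib power2_eq_square)
  then have "(norm c)\<^sup>2 * (norm y)\<^sup>2 = t * (norm (ip x y))\<^sup>2" by (simp add: t)
  then have "of_real ((norm (x - smul c y))\<^sup>2) = (of_real ((norm x)\<^sup>2 - t * (norm (ip x y))\<^sup>2) :: 'k)"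
    unfolding norm_diff_smul_sq c of_real_diff by simp
  then have "(norm (x - smul c y))\<^sup>2 = (norm x)\<^sup>2 - t * (norm (ip x y))\<^sup>2"
    by (simp only: of_real_eq_iff)
  then have "t * (norm (ip x y))\<^sup>2 \<le> (norm x)\<^sup>2"
    by (metis diff_ge_0_iff_ge zero_le_power2)
  then have "(norm (ip x y))\<^sup>2 \<le> (norm x * norm y)\<^sup>2"
    using False by (simp add: t_def field_simps power_mult_distrib)
  then show ?thesis by (rule power2_le_imp_le) simp
qed

text \<open>Bilinearity is meant over the reals, so conjugate linearity in the second argument does
  no harm. The gain is joint continuity of \<open>ip\<close>.\<close>

lemma bounded_bilinear_ip: "bounded_bilinear ip"
proof
  show "\<exists>K. \<forall>a b. norm (ip a b) \<le> norm a * norm b * K"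
    using norm_ip_le by (intro exI[of _ 1]) simp
qed (simp_all add: ip_add_left ip_add_right ip_scaleR_left ip_scaleR_right scaleR_conv_of_real)

lemmas tendsto_ip = bounded_bilinear.tendsto[OF bounded_bilinear_ip]

text \<open>Every vector of \<open>D\<close> is orthogonal to \<open>y - z\<close>, and by density
  \<open>y - z\<close> is itself a limit of such vectors.\<close>

lemma eq_if_ip_right_eq:
  assumes "closure D = UNIV" and "\<And>x. x \<in> D \<Longrightarrow> ip x y = ip x z"
  shows "y = z"
proof -
  obtain f where f: "\<And>n. f n \<in> D" "f \<longlonglongrightarrow> y - z"
    using assms(1) by (metis mem_closure_seqE UNIV_I)
  have "(\<lambda>n. ip (f n) (y - z)) \<longlonglongrightarrow> ip (y - z) (y - z)"
    by (intro tendsto_ip f tendsto_const)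
  moreover have "ip (f n) (y - z) = 0" for n
    using assms(2)[OF f(1)] by (simp add: ip_diff_right)
  ultimately have "ip (y - z) (y - z) = 0"
    by (simp add: LIMSEQ_const_iff)
  then show ?thesis by (simp add: ip_self)
qed

section \<open>Adjoints and selfadjointness\<close>

lemma adjoint_operator_eq_Some_iff:
  assumes "closure (dom T) = UNIV"
  shows "adjoint_operator ip T y = Some z \<longleftrightarrow> (\<forall>x\<in>dom T. ip (the (T x)) y = ip x z)"
proof -
  have *: "z' = z"
    if "\<forall>x\<in>dom T. ip (the (T x)) y = ip x z'" "\<forall>x\<in>dom T. ip (the (T x)) y = ip x z" for z z'
    using that by (intro eq_if_ip_right_eq[OF assms]) metis
  have "(THE z. \<forall>x\<in>dom T. ip (the (T x)) y = ip x z) = z"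
    if "\<forall>x\<in>dom T. ip (the (T x)) y = ip x z" for z
    using that * by (intro the_equality) blast
  then show ?thesis
    unfolding adjoint_operator_def by (smt (verit) option.distinct(1) option.inject)
qed

text \<open>Regularity from a weak identity: testing against the domain alone places
  \<open>y\<close> in it. Closedness of \<open>A\<close> and the domain condition for
  \<open>A^2\<close> are both obtained this way.\<close>

lemma selfadjoint_operatorD:
  assumes "selfadjoint_operator ip A" and "\<And>x. x \<in> dom A \<Longrightarrow> ip (the (A x)) y = ip x z"
  shows "A y = Some z"
  using assms adjoint_operator_eq_Some_iff[of A y z] by (simp add: selfadjoint_operator_def)

section \<open>Minimising a penalised distance over the domain of a selfadjoint operator\<close>

lemma linear_operator_diff:
  assumes "linear_operator smul A" "x \<in> dom A" "y \<in> dom A"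
  shows "x - y \<in> dom A" "the (A (x - y)) = the (A x) - the (A y)"
proof -
  have sub: "subspace (dom A)" using assms by (simp add: linear_operator_def)
  then show d: "x - y \<in> dom A" using assms subspace_diff by blast
  have "the (A (x - y + y)) = the (A (x - y)) + the (A y)"
    using d assms unfolding linear_operator_def by blast
  then show "the (A (x - y)) = the (A x) - the (A y)" by simp
qed

lemma linear_operator_smul:
  assumes "linear_operator smul A" "x \<in> dom A"
  shows "smul c x \<in> dom A" "the (A (smul c x)) = smul c (the (A x))"
  using assms subspace_scale unfolding linear_operator_def by blast+

lemma linear_operator_midpoint:
  assumes "linear_operator smul A" "x \<in> dom A" "y \<in> dom A"
  shows "(1/2) *\<^sub>R (x + y) \<in> dom A"
    and "the (A ((1/2) *\<^sub>R (x + y))) = (1/2) *\<^sub>R (the (A x) + the (A y))"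
proof -
  have "x + y \<in> dom A" "the (A (x + y)) = the (A x) + the (A y)"
    using assms subspace_add unfolding linear_operator_def by blast+
  then show "(1/2) *\<^sub>R (x + y) \<in> dom A"
    "the (A ((1/2) *\<^sub>R (x + y))) = (1/2) *\<^sub>R (the (A x) + the (A y))"
    using linear_operator_smul[OF assms(1), of "x + y" "of_real (1/2)"] unfolding smul_of_real by simp_all
qed

text \<open>The squared distance from \<open>(y, 0)\<close> to the graph point
  \<open>(x, A x)\<close>, with weight \<open>s\<close> on the second component. For
  \<open>s > 0\<close>, minimising it is an orthogonal projection onto the graph of
  \<open>A\<close>.\<close>

definition regularized_dist :: "('a \<rightharpoonup> 'a) \<Rightarrow> real \<Rightarrow> 'a \<Rightarrow> 'a \<Rightarrow> real" where
  "regularized_dist A s y x = (norm (y - x))\<^sup>2 + s * (norm (the (A x)))\<^sup>2"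

text \<open>The parallelogram law in the weighted product space, applied to the differences of
  \<open>(y, 0)\<close> and the two graph points. It turns nearly minimal values into closeness of
  both \<open>x\<close> and \<open>A x\<close>.\<close>

lemma regularized_dist_parallelogram:
  assumes "linear_operator smul A" "x \<in> dom A" "x' \<in> dom A"
  shows "(norm (x - x'))\<^sup>2 + s * (norm (the (A x) - the (A x')))\<^sup>2 =
    2 * regularized_dist A s y x + 2 * regularized_dist A s y x'
    - 4 * regularized_dist A s y ((1/2) *\<^sub>R (x + x'))"
proof -
  have "(y - x) + (y - x') = 2 *\<^sub>R (y - (1/2) *\<^sub>R (x + x'))"
    by (simp add: algebra_simps scaleR_2)
  then have 1: "(norm ((y - x) + (y - x')))\<^sup>2 = 4 * (norm (y - (1/2) *\<^sub>R (x + x')))\<^sup>2"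
    by (simp add: power_mult_distrib)
  have 2: "(norm (the (A x) + the (A x')))\<^sup>2 = 4 * (norm (the (A ((1/2) *\<^sub>R (x + x')))))\<^sup>2"
    unfolding linear_operator_midpoint(2)[OF assms] by (simp add: power_divide)
  have 3: "(norm ((y - x) - (y - x')))\<^sup>2 = (norm (x - x'))\<^sup>2"
    by (simp add: norm_minus_commute)
  have "s * (norm (the (A x) + the (A x')))\<^sup>2 + s * (norm (the (A x) - the (A x')))\<^sup>2
      = 2 * s * (norm (the (A x)))\<^sup>2 + 2 * s * (norm (the (A x')))\<^sup>2"
    using arg_cong[OF parallelogram[of "the (A x)" "the (A x')"], of "(*) s"]
    by (simp add: distrib_left)
  then show ?thesis
    using parallelogram[of "y - x" "y - x'"] unfolding regularized_dist_def 1 2 3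
    by (simp add: algebra_simps)
qed

lemma regularized_dist_minimizer:
  assumes lin: "linear_operator smul A" and sym: "symmetric_operator ip A"
    and sa: "selfadjoint_operator ip A" and s: "s > 0"
  obtains u where "u \<in> dom A" "\<And>x. x \<in> dom A \<Longrightarrow> regularized_dist A s y u \<le> regularized_dist A s y x"
proof -
  let ?Q = "regularized_dist A s y"
  define d where "d = Inf (?Q ` dom A)"
  have ne: "dom A \<noteq> {}"
    using sa by (auto simp: selfadjoint_operator_def)
  have Q0: "0 \<le> ?Q x" for x using s by (simp add: regularized_dist_def)
  have bdd: "bdd_below (?Q ` dom A)" using Q0 by (intro bdd_belowI[of _ 0]) auto
  have dle: "d \<le> ?Q x" if "x \<in> dom A" for x
    unfolding d_def using bdd that by (intro cInf_lower) auto
  have "\<exists>x\<in>dom A. ?Q x < d + inverse (real (Suc n))" for n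
    using cInf_lessD[of "?Q ` dom A" "d + inverse (real (Suc n))"] ne by (auto simp: d_def)
  then obtain f where f: "\<And>n. f n \<in> dom A" "\<And>n. ?Q (f n) < d + inverse (real (Suc n))"
    by metis
  \<comment> \<open>The midpoint lies in \<open>dom A\<close>, so its value is at least
    \<open>d\<close>, and the terms in \<open>d\<close> cancel in the parallelogram
    identity.\<close>
  have close: "(norm (f m - f n))\<^sup>2 + s * (norm (the (A (f m)) - the (A (f n))))\<^sup>2
      \<le> 4 * inverse (real (Suc N))" if "N \<le> m" "N \<le> n" for m n N
  proof -
    have "inverse (real (Suc m)) \<le> inverse (real (Suc N))" "inverse (real (Suc n)) \<le> inverse (real (Suc N))"
      using that by (simp_all add: field_simps)
    moreover have "d \<le> ?Q ((1/2) *\<^sub>R (f m + f n))"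
      using f by (intro dle linear_operator_midpoint[OF lin])
    ultimately show ?thesis
      using f(2)[of m] f(2)[of n] regularized_dist_parallelogram[OF lin f(1) f(1), of m n s y] by linarith
  qed
  \<comment> \<open>The constant \<open>c\<close> lets one argument serve both components:
    \<open>c = 1\<close> for \<open>f\<close> and \<open>c = s\<close> for its image under
    \<open>A\<close>.\<close>
  have cau: "Cauchy g" if g: "\<And>m n. c * (norm (g m - g n))\<^sup>2
      \<le> (norm (f m - f n))\<^sup>2 + s * (norm (the (A (f m)) - the (A (f n))))\<^sup>2" and c: "c > 0"
    for g :: "nat \<Rightarrow> 'a" and c
  proof (rule CauchyI)
    fix e :: real assume e: "0 < e"
    obtain N where N: "inverse (real (Suc N)) < c * e\<^sup>2 / 4"
      using reals_Archimedean[of "c * e\<^sup>2 / 4"] e c by auto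
    have "norm (g m - g n) < e" if "N \<le> m" "N \<le> n" for m n
    proof -
      have "c * (norm (g m - g n))\<^sup>2 < c * e\<^sup>2"
        using close[OF that] g[of m n] N by linarith
      then have "(norm (g m - g n))\<^sup>2 < e\<^sup>2" using c by simp
      then show ?thesis using e by (simp add: power2_less_imp_less)
    qed
    then show "\<exists>M. \<forall>m\<ge>M. \<forall>n\<ge>M. norm (g m - g n) < e" by blast
  qed
  have "Cauchy f" using s by (intro cau[of 1]) auto
  then obtain u where u: "f \<longlonglongrightarrow> u" using Cauchy_convergent convergent_def by blast
  have "Cauchy (\<lambda>n. the (A (f n)))" using s by (intro cau[of s]) auto
  then obtain v where v: "(\<lambda>n. the (A (f n))) \<longlonglongrightarrow> v" using Cauchy_convergent convergent_def by blast
  \<comment> \<open>A selfadjoint operator is closed: the symmetry relation with \<open>f n\<close>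
    passes to the limit.\<close>
  have Au: "A u = Some v"
  proof (rule selfadjoint_operatorD[OF sa])
    fix x assume x: "x \<in> dom A"
    have "(\<lambda>n. ip (the (A x)) (f n)) \<longlonglongrightarrow> ip (the (A x)) u"
      by (intro tendsto_ip u tendsto_const)
    moreover have "(\<lambda>n. ip x (the (A (f n)))) \<longlonglongrightarrow> ip x v"
      by (intro tendsto_ip v tendsto_const)
    moreover have "ip x (the (A (f n))) = ip (the (A x)) (f n)" for n
      using sym x f(1) by (simp add: symmetric_operator_def)
    ultimately show "ip (the (A x)) u = ip x v"
      using LIMSEQ_unique by simp
  qed
  have "(\<lambda>n. ?Q (f n)) \<longlonglongrightarrow> ?Q u"
    unfolding regularized_dist_def Au option.sel by (intro tendsto_intros u v)
  moreover have "(\<lambda>n. d + inverse (real (Suc n))) \<longlonglongrightarrow> d"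
    using tendsto_add[OF tendsto_const LIMSEQ_inverse_real_of_nat] by simp
  ultimately have "?Q u \<le> d"
    by (rule LIMSEQ_le) (use f(2) less_imp_le in blast)
  then show ?thesis using that[of u] Au dle by force
qed

text \<open>Vanishing of the first variation at the minimiser is the weak form of
  \<open>s A^2 u = y - u\<close>, and selfadjointness makes it strong. The final estimate is
  minimality without the term in \<open>A u\<close>; it yields convergence as \<open>s\<close> tends
  to 0.\<close>

lemma resolvent_of_square:
  assumes lin: "linear_operator smul A" and sym: "symmetric_operator ip A"
    and sa: "selfadjoint_operator ip A" and s: "s > 0"
  obtains u where "u \<in> dom A" "the (A u) \<in> dom A" "u + s *\<^sub>R the (A (the (A u))) = y"
    "\<And>x. x \<in> dom A \<Longrightarrow> (norm (y - u))\<^sup>2 \<le> (norm (y - x))\<^sup>2 + s * (norm (the (A x)))\<^sup>2"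
proof -
  obtain u where u: "u \<in> dom A"
    and min: "\<And>x. x \<in> dom A \<Longrightarrow> regularized_dist A s y u \<le> regularized_dist A s y x"
    using regularized_dist_minimizer[OF assms] by blast
  have euler: "ip (y - u) x = of_real s * ip (the (A u)) (the (A x))" if x: "x \<in> dom A" for x
  proof (rule ccontr)
    \<comment> \<open>\<open>e\<close> is the defect in the Euler equation. Moving \<open>u\<close>
      to \<open>u - t e x\<close> changes the functional by \<open>- 2 t |e|^2 + t^2 |e|^2 K\<close>
      for real \<open>t\<close>: the factor \<open>e\<close> in the step makes the linear term real
      and negative for \<open>t > 0\<close> over either field.\<close>
    define e where "e = of_real s * ip (the (A u)) (the (A x)) - ip (y - u) x"
    define K where "K = (norm x)\<^sup>2 + s * (norm (the (A x)))\<^sup>2"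
    assume "ip (y - u) x \<noteq> of_real s * ip (the (A u)) (the (A x))"
    then have e: "e \<noteq> 0" by (simp add: e_def)
    have K: "K \<ge> 0" using s by (simp add: K_def)
    have ineq: "2 * t * (norm e)\<^sup>2 \<le> t\<^sup>2 * (norm e)\<^sup>2 * K" for t
    proof -
      define c where "c = of_real t * e"
      let ?x = "u - smul c x"
      let ?p = "ip (y - u) x" and ?q = "ip (the (A u)) (the (A x))"
      have x': "?x \<in> dom A" "the (A ?x) = the (A u) - smul c (the (A x))"
        using linear_operator_diff[OF lin u linear_operator_smul(1)[OF lin x]]
          linear_operator_smul(2)[OF lin x] by auto
      have c: "(norm c)\<^sup>2 = t\<^sup>2 * (norm e)\<^sup>2"
        by (simp add: c_def norm_mult power_mult_distrib)
      have "y - ?x = (y - u) - smul (- c) x" by simp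
      then have 1: "of_real ((norm (y - ?x))\<^sup>2) = of_real ((norm (y - u))\<^sup>2)
          + of_real (t\<^sup>2 * (norm e)\<^sup>2 * (norm x)\<^sup>2) + (conjugate c * ?p + c * conjugate ?p)"
        by (simp only: norm_diff_smul_sq norm_minus_cancel c conjugate_minus) simp
      have 2: "of_real ((norm (the (A ?x)))\<^sup>2) = of_real ((norm (the (A u)))\<^sup>2)
          + of_real (t\<^sup>2 * (norm e)\<^sup>2 * (norm (the (A x)))\<^sup>2) - (conjugate c * ?q + c * conjugate ?q)"
        unfolding x'(2) norm_diff_smul_sq c ..
      have conj_e: "conjugate e = of_real s * conjugate ?q - conjugate ?p"
        by (simp add: e_def conjugate_diff conjugate_mult)
      have "(conjugate c * ?p + c * conjugate ?p) - of_real s * (conjugate c * ?q + c * conjugate ?q)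
          = - (conjugate c * e + c * conjugate e)"
        unfolding conj_e unfolding e_def by (simp add: algebra_simps)
      also have "conjugate c * e + c * conjugate e = of_real (2 * t * (norm e)\<^sup>2)"
        using mult_conjugate[of e] by (simp add: c_def conjugate_mult mult_ac)
      finally have cross: "(conjugate c * ?p + c * conjugate ?p)
          - of_real s * (conjugate c * ?q + c * conjugate ?q) = - of_real (2 * t * (norm e)\<^sup>2)" .
      have "of_real (regularized_dist A s y ?x) =
          of_real (regularized_dist A s y u + t\<^sup>2 * (norm e)\<^sup>2 * K)
          + ((conjugate c * ?p + c * conjugate ?p) - of_real s * (conjugate c * ?q + c * conjugate ?q))"
        unfolding regularized_dist_def K_def of_real_add of_real_mult[of s] 1 2
        by (simp add: algebra_simps)
      also have "\<dots> = of_real (regularized_dist A s y u - 2 * t * (norm e)\<^sup>2 + t\<^sup>2 * (norm e)\<^sup>2 * K)"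
        unfolding cross by simp
      finally have "regularized_dist A s y ?x =
        regularized_dist A s y u - 2 * t * (norm e)\<^sup>2 + t\<^sup>2 * (norm e)\<^sup>2 * K"
        by (simp only: of_real_eq_iff)
      with min[OF x'(1)] show ?thesis by simp
    qed
    \<comment> \<open>The inequality would force \<open>t * K >= 2\<close>, whereas this choice
      gives \<open>t * K < 1\<close>, including the case \<open>K = 0\<close>.\<close>
    define t where "t = 1 / (K + 1)"
    have t: "t > 0" "t * K = 1 - t" using K by (simp_all add: t_def field_simps)
    have "(norm e)\<^sup>2 * (2 * t) \<le> (norm e)\<^sup>2 * (t\<^sup>2 * K)"
      using ineq[of t] by (simp only: mult_ac)
    then have "2 * t \<le> t\<^sup>2 * K"
      by (rule mult_left_le_imp_le) (use e in simp)
    also have "t\<^sup>2 * K = t * (1 - t)"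
      using t(2) by (simp add: power2_eq_square)
    finally have "t + t * t \<le> 0" by (simp add: algebra_simps)
    then show False using t(1) by (smt (verit) mult_pos_pos)
  qed
  have "A (the (A u)) = Some ((1 / s) *\<^sub>R (y - u))"
  proof (rule selfadjoint_operatorD[OF sa])
    fix x assume x: "x \<in> dom A"
    have "conjugate (ip (y - u) x) = conjugate (of_real s * ip (the (A u)) (the (A x)))"
      using euler[OF x] by simp
    then have "ip x (y - u) = of_real s * ip (the (A x)) (the (A u))"
      by (simp add: conjugate_mult flip: ip_commute)
    then show "ip (the (A x)) (the (A u)) = ip x ((1 / s) *\<^sub>R (y - u))"
      using s unfolding ip_scaleR_right by simp
  qed
  moreover have "(norm (y - u))\<^sup>2 \<le> (norm (y - x))\<^sup>2 + s * (norm (the (A x)))\<^sup>2" if "x \<in> dom A" for x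
    using min[OF that] s unfolding regularized_dist_def
    by (smt (verit) mult_nonneg_nonneg zero_le_power2)
  ultimately show ?thesis using that[of u] u s by (simp add: domI)
qed

section \<open>Commutation with the regularisation\<close>

text \<open>The last hypothesis says that \<open>y\<close> is in the domain of the adjoint of
  \<open>B\<close>, with image \<open>z\<close>. Regularising \<open>y\<close> and \<open>z\<close>
  with the same \<open>s\<close> gives a point of the graph of \<open>B\<close> near
  \<open>(y, z)\<close>.\<close>

lemma adjoint_mem_closure_graph:
  assumes linA: "linear_operator smul A" and symA: "symmetric_operator ip A"
    and sa: "selfadjoint_operator ip A"
    and symB: "symmetric_operator ip B" and dom: "dom B = dom A"
    and comm: "\<And>x y. x \<in> dom A \<Longrightarrow> y \<in> dom A \<Longrightarrow> ip (the (A x)) (the (B y)) = ip (the (B x)) (the (A y))"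
    and adj: "\<And>x. x \<in> dom B \<Longrightarrow> ip (the (B x)) y = ip x z"
  shows "(y, z) \<in> closure (Map.graph B)"
proof -
  let ?D = "dom A"
  have dense: "closure ?D = UNIV" using sa by (simp add: selfadjoint_operator_def)
  have sA: "ip (the (A a)) b = ip a (the (A b))" if "a \<in> ?D" "b \<in> ?D" for a b
    using symA that by (simp add: symmetric_operator_def)
  have sB: "ip (the (B a)) b = ip a (the (B b))" if "a \<in> ?D" "b \<in> ?D" for a b
    using symB that dom by (simp add: symmetric_operator_def)
  have adj': "ip y (the (B x)) = ip z x" if "x \<in> ?D" for x
    using adj[of x] that dom by (metis ip_commute)
  \<comment> \<open>Test against an arbitrary \<open>h\<close>, written as
    \<open>w + s A^2 w\<close>. Two uses of \<open>comm\<close> with the symmetry of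
    \<open>B\<close> between them carry both factors \<open>A\<close> from \<open>w\<close> to
    \<open>u\<close>; \<open>B\<close> is applied only to \<open>u\<close>, \<open>w\<close>,
    \<open>A u\<close> and \<open>A w\<close>, all in the domain.\<close>
  have resolvent_commute: "the (B u) = u'"
    if s: "s > 0" and u: "u \<in> ?D" "the (A u) \<in> ?D" "u + s *\<^sub>R the (A (the (A u))) = y"
      and u': "u' \<in> ?D" "the (A u') \<in> ?D" "u' + s *\<^sub>R the (A (the (A u'))) = z" for s u u'
  proof (rule eq_if_ip_right_eq[of UNIV])
    fix h
    obtain w where w: "w \<in> ?D" "the (A w) \<in> ?D" "w + s *\<^sub>R the (A (the (A w))) = h"
      using resolvent_of_square[OF linA symA sa s] by metis
    have "ip (the (B u)) h = ip (the (B u)) w + of_real s * ip (the (B u)) (the (A (the (A w))))"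
      by (simp add: ip_add_right ip_scaleR_right flip: w(3))
    also have "\<dots> = ip u (the (B w)) + of_real s * ip (the (A u)) (the (B (the (A w))))"
      using sB comm u w by simp
    also have "\<dots> = ip u (the (B w)) + of_real s * ip (the (A (the (A u)))) (the (B w))"
      using sB comm u w by simp
    also have "\<dots> = ip y (the (B w))"
      by (simp add: ip_add_left ip_scaleR_left flip: u(3))
    also have "\<dots> = ip z w" using adj' w by simp
    also have "\<dots> = ip u' w + of_real s * ip (the (A (the (A u')))) w"
      by (simp add: ip_add_left ip_scaleR_left flip: u'(3))
    also have "\<dots> = ip u' h"
      using sA u' w by (simp add: ip_add_right ip_scaleR_right flip: w(3))
    finally show "ip h (the (B u)) = ip h u'" by (metis ip_commute)
  qed simp
  \<comment> \<open>Compare with a fixed \<open>x\<close> of the domain within \<open>e / 2\<close>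
    of \<open>h\<close>; for small \<open>s\<close> its penalty is at most \<open>e^2 / 4\<close>.
    The bound holds for all \<open>s\<close> below a threshold, so that two vectors can share one
    \<open>s\<close>.\<close>
  have approx: "\<exists>r>0. \<forall>s. 0 < s \<and> s \<le> r \<longrightarrow> (\<forall>u.
      (\<forall>x\<in>?D. (norm (h - u))\<^sup>2 \<le> (norm (h - x))\<^sup>2 + s * (norm (the (A x)))\<^sup>2) \<longrightarrow> norm (h - u) < e)"
    if e: "e > 0" for h e
  proof -
    have "h \<in> closure ?D" using dense by simp
    then obtain x where x: "x \<in> ?D" "norm (h - x) < e / 2"
      using e closure_approachable[of h ?D] by (metis dist_commute dist_norm half_gt_zero)
    define M where "M = (norm (the (A x)))\<^sup>2 + 1"
    have M: "M > 0" by (simp add: M_def add_nonneg_pos)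
    have "norm (h - u) < e" if s: "0 < s" "s \<le> e\<^sup>2 / (4 * M)"
      and u: "\<forall>x\<in>?D. (norm (h - u))\<^sup>2 \<le> (norm (h - x))\<^sup>2 + s * (norm (the (A x)))\<^sup>2" for s u
    proof -
      have "s * (norm (the (A x)))\<^sup>2 \<le> s * M" using s by (simp add: M_def)
      also have "\<dots> \<le> e\<^sup>2 / 4" using s M by (simp add: field_simps)
      finally have "(norm (h - u))\<^sup>2 \<le> (norm (h - x))\<^sup>2 + e\<^sup>2 / 4" using u x by force
      also have "(norm (h - x))\<^sup>2 < (e / 2)\<^sup>2" using x e by (intro power_strict_mono) auto
      finally have "2 * (norm (h - u))\<^sup>2 < e\<^sup>2" by (simp add: power_divide)
      then have "(norm (h - u))\<^sup>2 < e\<^sup>2" using zero_le_power2[of "norm (h - u)"] by linarith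
      then show ?thesis using e by (simp add: power2_less_imp_less)
    qed
    then show ?thesis using e M by (intro exI[of _ "e\<^sup>2 / (4 * M)"]) auto
  qed
  show ?thesis unfolding closure_approachable
  proof (intro allI impI)
    fix e :: real assume e: "0 < e"
    then have e2: "e / 2 > 0" by simp
    obtain r where r: "r > 0" "\<And>s u. 0 < s \<Longrightarrow> s \<le> r \<Longrightarrow>
      (\<forall>x\<in>?D. (norm (y - u))\<^sup>2 \<le> (norm (y - x))\<^sup>2 + s * (norm (the (A x)))\<^sup>2) \<Longrightarrow> norm (y - u) < e / 2"
      using approx[OF e2, of y] by blast
    obtain r' where r': "r' > 0" "\<And>s u. 0 < s \<Longrightarrow> s \<le> r' \<Longrightarrow>
      (\<forall>x\<in>?D. (norm (z - u))\<^sup>2 \<le> (norm (z - x))\<^sup>2 + s * (norm (the (A x)))\<^sup>2) \<Longrightarrow> norm (z - u) < e / 2"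
      using approx[OF e2, of z] by blast
    \<comment> \<open>\<open>resolvent_commute\<close> relates \<open>u\<close> and
      \<open>u'\<close> only for a common parameter.\<close>
    define s where "s = min r r'"
    have s: "s > 0" "s \<le> r" "s \<le> r'" using r r' by (auto simp: s_def)
    obtain u where u: "u \<in> ?D" "the (A u) \<in> ?D" "u + s *\<^sub>R the (A (the (A u))) = y"
      "\<And>x. x \<in> ?D \<Longrightarrow> (norm (y - u))\<^sup>2 \<le> (norm (y - x))\<^sup>2 + s * (norm (the (A x)))\<^sup>2"
      using resolvent_of_square[OF linA symA sa s(1)] by metis
    obtain u' where u': "u' \<in> ?D" "the (A u') \<in> ?D" "u' + s *\<^sub>R the (A (the (A u'))) = z"
      "\<And>x. x \<in> ?D \<Longrightarrow> (norm (z - u'))\<^sup>2 \<le> (norm (z - x))\<^sup>2 + s * (norm (the (A x)))\<^sup>2"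
      using resolvent_of_square[OF linA symA sa s(1)] by metis
    have "the (B u) = u'" using resolvent_commute s(1) u(1-3) u'(1-3) .
    then have "(u, u') \<in> Map.graph B" using u(1) unfolding dom[symmetric] by (auto simp: Map.graph_def)
    moreover have "dist (u, u') (y, z) < e"
    proof -
      have "dist (u, u') (y, z) \<le> dist u y + dist u' z"
        unfolding dist_Pair_Pair by (rule sqrt_sum_squares_le_sum) auto
      also have "\<dots> < e"
        using r(2)[OF s(1,2)] r'(2)[OF s(1,3)] u(4) u'(4)
        by (simp add: dist_norm norm_minus_commute) (smt (verit, best) field_sum_of_halves)
      finally show ?thesis .
    qed
    ultimately show "\<exists>p\<in>Map.graph B. dist p (y, z) < e" by blast
  qed
qed

section \<open>Closures of symmetric operators\<close>

lemma ip_closure_graph: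
  assumes symB: "symmetric_operator ip B"
    and "(x, x') \<in> closure (Map.graph B)" "(y, y') \<in> closure (Map.graph B)"
  shows "ip x' y = ip x y'"
proof -
  obtain f where f: "\<And>n. f n \<in> dom B" "f \<longlonglongrightarrow> x" "(\<lambda>n. the (B (f n))) \<longlonglongrightarrow> x'"
    using mem_closure_graphE[OF assms(2)] by blast
  obtain g where g: "\<And>n. g n \<in> dom B" "g \<longlonglongrightarrow> y" "(\<lambda>n. the (B (g n))) \<longlonglongrightarrow> y'"
    using mem_closure_graphE[OF assms(3)] by blast
  have "(\<lambda>n. ip (the (B (f n))) (g n)) \<longlonglongrightarrow> ip x' y" by (intro tendsto_ip f g)
  moreover have "(\<lambda>n. ip (f n) (the (B (g n)))) \<longlonglongrightarrow> ip x y'" by (intro tendsto_ip f g)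
  moreover have "ip (f n) (the (B (g n))) = ip (the (B (f n))) (g n)" for n
    using symB f g by (simp add: symmetric_operator_def)
  ultimately show ?thesis using LIMSEQ_unique by simp
qed

text \<open>Two limits over the same \<open>x\<close> have the same inner product with every
  \<open>v\<close> in the dense domain, namely \<open>ip (the (B v)) x\<close>.\<close>

lemma closable_operator_symmetric:
  assumes "symmetric_operator ip B" and dense: "closure (dom B) = UNIV"
  shows "closable_operator B"
  unfolding closable_operator_def
proof (rule single_valuedI)
  fix x y y' assume xy: "(x, y) \<in> closure (Map.graph B)" "(x, y') \<in> closure (Map.graph B)"
  show "y = y'"
  proof (rule eq_if_ip_right_eq[OF dense])
    fix v assume "v \<in> dom B"
    then have "(v, the (B v)) \<in> closure (Map.graph B)"
      by (intro subsetD[OF closure_subset]) (auto simp: Map.graph_def)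
    then show "ip v y = ip v y'"
      using ip_closure_graph[OF assms(1)] xy by metis
  qed
qed

text \<open>Symmetry survives in the closure, so the closure is contained in its adjoint.
  Conversely, the adjoint relation for the closure restricts to \<open>dom B\<close>, where
  \<open>adj\<close> returns the pair to the closed graph.\<close>

lemma selfadjoint_closure_operator:
  assumes symB: "symmetric_operator ip B" and dense: "closure (dom B) = UNIV"
    and adj: "\<And>y z. (\<And>x. x \<in> dom B \<Longrightarrow> ip (the (B x)) y = ip x z) \<Longrightarrow> (y, z) \<in> closure (Map.graph B)"
  shows "selfadjoint_operator ip (closure_operator B)"
proof -
  let ?C = "closure_operator B"
  have C: "?C x = Some y \<longleftrightarrow> (x, y) \<in> closure (Map.graph B)" for x y
    using graph_closure_operator[OF closable_operator_symmetric[OF symB dense]]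
    by (auto simp: Map.graph_def)
  have extends: "?C x = B x" if "x \<in> dom B" for x
    using that C subsetD[OF closure_subset, of _ "Map.graph B"] by (fastforce simp: Map.graph_def)
  then have dom_subset: "dom B \<subseteq> dom ?C" by (metis domIff subsetI)
  then have denseC: "closure (dom ?C) = UNIV"
    using dense closure_mono by blast
  have "adjoint_operator ip ?C y = Some z \<longleftrightarrow> ?C y = Some z" for y z
  proof -
    have "(\<forall>x\<in>dom ?C. ip (the (?C x)) y = ip x z) \<longleftrightarrow> (y, z) \<in> closure (Map.graph B)"
    proof
      assume "\<forall>x\<in>dom ?C. ip (the (?C x)) y = ip x z"
      then show "(y, z) \<in> closure (Map.graph B)"
        using dom_subset extends by (intro adj) (metis subsetD)
    next
      assume yz: "(y, z) \<in> closure (Map.graph B)"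
      have "(x, the (?C x)) \<in> closure (Map.graph B)" if "x \<in> dom ?C" for x
        using that by (auto simp flip: C)
      then show "\<forall>x\<in>dom ?C. ip (the (?C x)) y = ip x z"
        using ip_closure_graph[OF symB] yz by blast
    qed
    then show ?thesis
      unfolding adjoint_operator_eq_Some_iff[OF denseC] C .
  qed
  then have "adjoint_operator ip ?C = ?C"
    by (intro ext) (metis not_None_eq)
  then show ?thesis using denseC by (simp add: selfadjoint_operator_def)
qed

lemma essentially_selfadjoint_on_of_commuting:
  assumes "linear_operator smul A" "symmetric_operator ip A" "selfadjoint_operator ip A"
    and symB: "symmetric_operator ip B" and dom: "dom B = dom A"
    and "\<And>x y. x \<in> dom A \<Longrightarrow> y \<in> dom A \<Longrightarrow> ip (the (A x)) (the (B y)) = ip (the (B x)) (the (A y))"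
  shows "essentially_selfadjoint_on smul ip B (dom A)"
proof -
  have dense: "closure (dom B) = UNIV"
    using assms by (simp add: selfadjoint_operator_def)
  have "B |` dom A = B"
    unfolding dom[symmetric] by (auto simp: restrict_map_def fun_eq_iff domIff)
  moreover have "subspace (dom A)" using assms by (simp add: linear_operator_def)
  moreover have "selfadjoint_operator ip (closure_operator B)"
    using adjoint_mem_closure_graph[OF assms] by (rule selfadjoint_closure_operator[OF symB dense])
  ultimately show ?thesis
    using closable_operator_symmetric[OF symB dense] dom by (simp add: essentially_selfadjoint_on_def)
qed

end

theorem theorem3p9:
  fixes smul :: "'k::real_or_complex \<Rightarrow> 'a::banach \<Rightarrow> 'a"
    and ip :: "'a \<Rightarrow> 'a \<Rightarrow> 'k"
    and A B :: "'a \<rightharpoonup> 'a"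
    and D :: "'a set"
  assumes "hilbert_space smul ip"
    and "linear_operator smul A" and "symmetric_operator ip A"
    and "linear_operator smul B" and "symmetric_operator ip B"
    and "D = dom A" and "D = dom B" and "closure D = UNIV"
    and "selfadjoint_operator ip A"
    and "\<forall>x\<in>D. \<forall>y\<in>D. ip (the (A x)) (the (B y)) = ip (the (B x)) (the (A y))"
  shows "essentially_selfadjoint_on smul ip B D \<and>
         essentially_selfadjoint_on smul ip (add_operator A B) D"
proof
  interpret hilbert_space smul ip by fact
  have dom: "dom (add_operator A B) = dom A" "dom B = dom A"
    using assms by (auto simp: add_operator_def dom_def)
  have add: "the (add_operator A B x) = the (A x) + the (B x)" if "x \<in> dom A" for x
    using that dom(2) by (simp add: add_operator_def)
  show "essentially_selfadjoint_on smul ip B D"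
    using assms essentially_selfadjoint_on_of_commuting by metis
  have "symmetric_operator ip (add_operator A B)"
    using assms(3,5) dom add unfolding symmetric_operator_def
    by (simp add: ip_add_left ip_add_right)
  \<comment> \<open>In the commutation identity for \<open>A + B\<close>, the new term
    \<open>ip (the (A x)) (the (A y))\<close> occurs on both sides.\<close>
  then show "essentially_selfadjoint_on smul ip (add_operator A B) D"
    unfolding \<open>D = dom A\<close> using assms dom add
    by (intro essentially_selfadjoint_on_of_commuting) (simp_all add: ip_add_left ip_add_right)
qed

end
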